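(* Let $G$ be a cubic graph with a (proper) $3$-edge-colouring $c$. If there is a prune-pair (with respect to $c$) for an edge-quadruple $\{\{e_1,e_2\},\{e_3,e_4\}\}$ of $G$, then the graph obtained by applying the $\mathcal{H}$ operation to $\{\{e_1,e_2\},\{e_3,e_4\}\}$ is $3$-edge-colourable.
   Context: Graphs are finite and simple; a cubic graph is a $3$-regular graph. Edge-colourings are proper and use colours $1,2,3$. An edge-quadruple is a set $\{\{e_1,e_2\},\{e_3,e_4\}\}$ of two sets, each containing two edges, with all four edges pairwise different. The $\mathcal{H}$ (insertion/expansion) operation applied to an edge-quadruple $\{\{e_1,e_2\},\{e_3,e_4\}\}$ of a cubic graph subdivides each $e_i$ with a new vertex $v_i$, and adds two new adjacent vertices $a,b$ with $a$ adjacent to $v_1,v_2$ and $b$ adjacent to $v_3,v_4$. Let $\{c_1,c_2,c_3\}=\{1,2,3\}$. In a $3$-edge-coloured cubic graph, a $(c_1,c_2)$-path from an edge $e$ coloured $c_1$ to an edge $e'$ is a path starting with the edge $e$ and ending with the edge $e'$ that contains only edges with colours $c_1$ and $c_2$ (the colour of $e'$ can be either $c_1$ or $c_2$). A prune-pair for $\{\{e_1,e_2\},\{e_3,e_4\}\}$ is, for some $c_1,c_2,c_3$ with $\{c_1,c_2,c_3\}=\{1,2,3\}$, a $(c_1,c_2)$-path from $e_1$ to $e_3$ together with an edge-disjoint $(c_1,c_3)$-path from $e_2$ to $e_4$ (in particular $e_1$ and $e_2$ both have colour $c_1$). *)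

theory Defs
  imports Main
begin

record 'a graph =
  verts :: "'a set"
  edges :: "'a set set"

definition simple_graph :: "'a graph \<Rightarrow> bool" where
  "simple_graph G \<longleftrightarrow> finite (verts G) \<and> (\<forall>e\<in>edges G. e \<subseteq> verts G \<and> card e = 2)"

definition degree :: "'a graph \<Rightarrow> 'a \<Rightarrow> nat" where
  "degree G v = card {e \<in> edges G. v \<in> e}"

definition cubic_graph :: "'a graph \<Rightarrow> bool" where
  "cubic_graph G \<longleftrightarrow> simple_graph G \<and> (\<forall>v\<in>verts G. degree G v = 3)"

definition three_edge_colouring :: "'a graph \<Rightarrow> ('a set \<Rightarrow> nat) \<Rightarrow> bool" where
  "three_edge_colouring G c \<longleftrightarrow>
     (\<forall>e\<in>edges G. c e \<in> {1, 2, 3}) \<and>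
     (\<forall>e\<in>edges G. \<forall>f\<in>edges G. e \<noteq> f \<and> e \<inter> f \<noteq> {} \<longrightarrow> c e \<noteq> c f)"

definition three_edge_colourable :: "'a graph \<Rightarrow> bool" where
  "three_edge_colourable G \<longleftrightarrow> (\<exists>c. three_edge_colouring G c)"

definition edge_quadruple :: "'a graph \<Rightarrow> 'a set set set \<Rightarrow> bool" where
  "edge_quadruple G Q \<longleftrightarrow>
     (\<exists>e1 e2 e3 e4. {e1, e2, e3, e4} \<subseteq> edges G \<and> distinct [e1, e2, e3, e4] \<and>
        Q = {{e1, e2}, {e3, e4}})"

text \<open>
  Vertices of the graph after insertion: the vertices of the original graph, one vertex
  subdividing each edge of the quadruple, and one new vertex for each of the two pairs
  of the quadruple.
\<close>

datatype 'a hvertex = Old 'a | Subdiv "'a set" | Hub "'a set set"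

text \<open>
  For \<open>Q = {{e1, e2}, {e3, e4}}\<close>, the vertices \<open>a\<close> and \<open>b\<close> are \<open>Hub {e1, e2}\<close> and
  \<open>Hub {e3, e4}\<close>, so \<open>Hub ` Q\<close> is the single edge joining them.
\<close>

definition H_operation :: "'a graph \<Rightarrow> 'a set set set \<Rightarrow> 'a hvertex graph" where
  "H_operation G Q =
     \<lparr> verts = Old ` verts G \<union> Subdiv ` (\<Union>Q) \<union> Hub ` Q,
       edges = (\<lambda>e. Old ` e) ` (edges G - \<Union>Q)
             \<union> {{Old v, Subdiv e} | v e. e \<in> \<Union>Q \<and> v \<in> e}
             \<union> {{Subdiv e, Hub p} | e p. p \<in> Q \<and> e \<in> p}
             \<union> {Hub ` Q} \<rparr>"

text \<open>A path is given by the list of its (distinct) vertices.\<close>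

fun path_edges :: "'a list \<Rightarrow> 'a set list" where
  "path_edges (u # v # vs) = {u, v} # path_edges (v # vs)"
| "path_edges _ = []"

definition is_path :: "'a graph \<Rightarrow> 'a list \<Rightarrow> bool" where
  "is_path G p \<longleftrightarrow>
     p \<noteq> [] \<and> distinct p \<and> set p \<subseteq> verts G \<and> set (path_edges p) \<subseteq> edges G"

definition coloured_path ::
  "'a graph \<Rightarrow> ('a set \<Rightarrow> nat) \<Rightarrow> nat \<Rightarrow> nat \<Rightarrow> 'a set \<Rightarrow> 'a set \<Rightarrow> 'a list \<Rightarrow> bool" where
  "coloured_path G c c1 c2 e e' p \<longleftrightarrow>
     is_path G p \<and> path_edges p \<noteq> [] \<and>
     hd (path_edges p) = e \<and> last (path_edges p) = e' \<and>
     c e = c1 \<and> (\<forall>f\<in>set (path_edges p). c f \<in> {c1, c2})"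

definition prune_pair ::
  "'a graph \<Rightarrow> ('a set \<Rightarrow> nat) \<Rightarrow> 'a set set set \<Rightarrow> 'a list \<Rightarrow> 'a list \<Rightarrow> bool" where
  "prune_pair G c Q p p' \<longleftrightarrow>
     (\<exists>e1 e2 e3 e4 c1 c2 c3.
        Q = {{e1, e2}, {e3, e4}} \<and> {c1, c2, c3} = {1, 2, 3} \<and>
        coloured_path G c c1 c2 e1 e3 p \<and>
        coloured_path G c c1 c3 e2 e4 p' \<and>
        set (path_edges p) \<inter> set (path_edges p') = {})"

end

theory Submission
  imports Defs "HOL-Combinatorics.Transposition"
begin

text \<open>
  Exchange the two colours at every interior vertex of each of the two paths. All edges at such a
  vertex that carry a colour of the path belong to the path, so the two ends of an edge outside the
  quadruple still see the same colour. An end edge of a path has exactly one interior vertex of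
  that path, so its two halves get the two colours of the path. Hence the third edge at a
  subdividing vertex can be coloured \<open>c3\<close> for \<open>e1\<close> and \<open>e3\<close>, and \<open>c2\<close> for \<open>e2\<close> and \<open>e4\<close>, which
  leaves \<open>c1\<close> for the edge joining the two hubs.
\<close>

section \<open>Interior vertices of a path\<close>

definition path_interior :: "'a list \<Rightarrow> 'a set" where
  "path_interior p = {p ! i | i. 0 < i \<and> Suc i < length p}"

lemma path_edges_conv_nth:
  "path_edges p = map (\<lambda>i. {p ! i, p ! Suc i}) [0..<length p - 1]"
proof (induction p rule: path_edges.induct)
  case (1 u v vs)
  have "[0..<length (u # v # vs) - 1] = 0 # map Suc [0..<length (v # vs) - 1]"
    by (simp add: map_Suc_upt upt_conv_Cons del: upt_Suc)
  with 1 show ?case by (simp del: upt_Suc)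
qed auto

lemma path_interior_two_edges:
  assumes "distinct p" and "v \<in> path_interior p"
  obtains f g where "f \<in> set (path_edges p)" "g \<in> set (path_edges p)" "f \<noteq> g" "v \<in> f" "v \<in> g"
proof -
  from assms(2) obtain i where i: "0 < i" "Suc i < length p" "v = p ! i"
    by (auto simp: path_interior_def)
  let ?f = "{p ! (i - 1), p ! Suc (i - 1)}" and ?g = "{p ! i, p ! Suc i}"
  have "?f \<in> set (path_edges p)" "?g \<in> set (path_edges p)"
    using i unfolding path_edges_conv_nth set_map by (intro imageI; simp)+
  moreover have "?f \<noteq> ?g"
    using i assms(1) by (auto simp: doubleton_eq_iff nth_eq_iff_index_eq)
  ultimately show thesis using that i by auto
qed

text \<open>This makes one and the same colour exchange act at both ends of a path edge other than
  the first and the last.\<close>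

lemma path_edge_subset_interior:
  assumes "f \<in> set (path_edges p)" "f \<noteq> hd (path_edges p)" "f \<noteq> last (path_edges p)"
  shows "f \<subseteq> path_interior p"
proof -
  from assms(1) obtain i where i: "i < length p - 1" "f = {p ! i, p ! Suc i}"
    by (auto simp: path_edges_conv_nth)
  have "i \<noteq> 0"
    using assms(2) i by (auto simp: path_edges_conv_nth hd_map)
  moreover have "Suc i \<noteq> length p - 1"
  proof
    assume "Suc i = length p - 1"
    then have "[0..<length p - 1] = [0..<i] @ [i]" by (metis le0 upt_Suc)
    with assms(3) i(2) show False by (simp add: path_edges_conv_nth)
  qed
  ultimately show ?thesis using i by (auto simp: path_interior_def)
qed

text \<open>Different first and last edges force a path of at least two edges, so the neighbour of
  each end of the path is interior; the end itself is not, since vertices do not repeat.\<close>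

lemma path_end_edges:
  assumes "distinct p" "path_edges p \<noteq> []" "hd (path_edges p) \<noteq> last (path_edges p)"
    and "e \<in> {hd (path_edges p), last (path_edges p)}"
  obtains u v where "e = {u, v}" "u \<notin> path_interior p" "v \<in> path_interior p"
proof -
  define n where "n = length p - 1"
  have n: "n > 0" "length p = Suc n"
    using assms(2) by (auto simp: n_def path_edges_conv_nth)
  \<comment> \<open>Both edges are written from the end of the path inwards, to match the order of
    \<open>u\<close> and \<open>v\<close>.\<close>
  have ends: "hd (path_edges p) = {p ! 0, p ! Suc 0}" "last (path_edges p) = {p ! n, p ! (n - 1)}"
    using n by (auto simp: path_edges_conv_nth hd_map last_map)
  have "n \<noteq> 1"
    using assms(3) unfolding ends by (auto simp: insert_commute)
  with n have inner: "p ! Suc 0 \<in> path_interior p" "p ! (n - 1) \<in> path_interior p"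
    unfolding path_interior_def by force+
  have "p ! 0 \<notin> path_interior p" "p ! n \<notin> path_interior p"
    using assms(1) n by (auto simp: path_interior_def nth_eq_iff_index_eq)
  with ends inner assms(4) that show thesis by blast
qed

text \<open>The two path edges at \<open>v\<close> have different colours by properness, so they use
  up both \<open>a\<close> and \<open>b\<close>; an edge at \<open>v\<close> with one of these
  colours must be one of them.\<close>

lemma coloured_path_saturated:
  assumes "three_edge_colouring G c" "coloured_path G c a b e e' p"
    and "v \<in> path_interior p" "f \<in> edges G" "v \<in> f" "c f \<in> {a, b}"
  shows "f \<in> set (path_edges p)"
proof -
  have p: "distinct p" "set (path_edges p) \<subseteq> edges G" "\<forall>g\<in>set (path_edges p). c g \<in> {a, b}"
    using assms(2) by (auto simp: coloured_path_def is_path_def)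
  have proper: "c g \<noteq> c h" if "g \<in> edges G" "h \<in> edges G" "g \<noteq> h" "v \<in> g" "v \<in> h" for g h
    using assms(1) that unfolding three_edge_colouring_def by blast
  obtain g h where gh: "g \<in> set (path_edges p)" "h \<in> set (path_edges p)" "g \<noteq> h" "v \<in> g" "v \<in> h"
    using path_interior_two_edges[OF p(1) assms(3)] .
  have "c g \<noteq> c h" using proper gh p(2) by blast
  moreover have "c g \<in> {a, b}" "c h \<in> {a, b}" using gh p(3) by blast+
  ultimately have "c f = c g \<or> c f = c h" using assms(6) by auto
  then show ?thesis using proper[of f] gh p(2) assms(4,5) by (metis subsetD)
qed

section \<open>Colourings of the expanded graph\<close>

text \<open>
  \<open>h v e\<close> is the colour that the vertex \<open>v\<close> sees on \<open>e\<close>, \<open>d e\<close> the colour of the edge from the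
  vertex subdividing \<open>e\<close> to its hub, and \<open>k\<close> the colour of the edge between the hubs.
\<close>

lemma H_operation_colourable:
  fixes h :: "'a \<Rightarrow> 'a set \<Rightarrow> nat"
  assumes ne: "\<And>e. e \<in> edges G \<Longrightarrow> e \<noteq> {}"
    and Q_ne: "Q \<noteq> {}"
    and Q: "\<Union>Q \<subseteq> edges G" "\<And>p q. p \<in> Q \<Longrightarrow> q \<in> Q \<Longrightarrow> p \<noteq> q \<Longrightarrow> p \<inter> q = {}"
    and range: "k \<in> {1, 2, 3}" "\<And>e. e \<in> \<Union>Q \<Longrightarrow> d e \<in> {1, 2, 3}"
      "\<And>v e. e \<in> edges G \<Longrightarrow> v \<in> e \<Longrightarrow> h v e \<in> {1, 2, 3}"
    and old: "\<And>v e f. e \<in> edges G \<Longrightarrow> f \<in> edges G \<Longrightarrow> v \<in> e \<Longrightarrow> v \<in> f \<Longrightarrow> e \<noteq> f \<Longrightarrow> h v e \<noteq> h v f"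
    and agree: "\<And>u v e. e \<in> edges G - \<Union>Q \<Longrightarrow> u \<in> e \<Longrightarrow> v \<in> e \<Longrightarrow> h u e = h v e"
    and subdiv: "\<And>u v e. e \<in> \<Union>Q \<Longrightarrow> u \<in> e \<Longrightarrow> v \<in> e \<Longrightarrow> u \<noteq> v \<Longrightarrow> h u e \<noteq> h v e"
      "\<And>v e. e \<in> \<Union>Q \<Longrightarrow> v \<in> e \<Longrightarrow> h v e \<noteq> d e"
    and hub: "\<And>p. p \<in> Q \<Longrightarrow> inj_on d p" "\<And>e. e \<in> \<Union>Q \<Longrightarrow> d e \<noteq> k"
  shows "three_edge_colourable (H_operation G Q)"
proof -
  \<comment> \<open>The kinds of vertices in \<open>X\<close> tell which of the four sorts of edges
    it is. In the last case \<open>SOME\<close> is harmless: by \<open>agree\<close> every end of an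
    edge outside the quadruple sees the same colour.\<close>
  define c where "c X =
    (if \<exists>p. Hub p \<in> X then if \<exists>e. Subdiv e \<in> X then d (THE e. Subdiv e \<in> X) else k
     else if \<exists>e. Subdiv e \<in> X then h (THE v. Old v \<in> X) (THE e. Subdiv e \<in> X)
     else h (SOME v. Old v \<in> X) {v. Old v \<in> X})" for X :: "'a hvertex set"
  let ?E = "edges (H_operation G Q)"
  have c_sub: "c {Old v, Subdiv e} = h v e" and c_hub: "c {Subdiv e, Hub p} = d e" for v e p
    by (simp_all add: c_def)
  have c_old: "c (Old ` e) = h v e" if "e \<in> edges G - \<Union>Q" "v \<in> e" for v e
  proof -
    have "c (Old ` e) = h (SOME v. v \<in> e) e" by (auto simp: c_def image_iff)
    also have "\<dots> = h v e" using that by (intro agree) (auto intro: someI)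
    finally show ?thesis .
  qed
  have c_mid: "c (Hub ` Q) = k"
    using Q_ne by (auto simp: c_def)
  have shape: "(\<exists>e\<in>edges G - \<Union>Q. X = Old ` e) \<or> (\<exists>e\<in>\<Union>Q. \<exists>v\<in>e. X = {Old v, Subdiv e}) \<or>
      (\<exists>p\<in>Q. \<exists>e\<in>p. X = {Subdiv e, Hub p}) \<or> X = Hub ` Q" if "X \<in> ?E" for X
    using that unfolding H_operation_def graph.select_convs Un_iff image_iff mem_Collect_eq singleton_iff
    by (elim disjE exE conjE) blast+
  \<comment> \<open>\<open>X\<close> is determined by \<open>v\<close> and \<open>e\<close>, so
    distinct new edges at \<open>Old v\<close> come from distinct edges of \<open>G\<close>, and
    \<open>old\<close> applies to them.\<close>
  have at_old: "\<exists>e\<in>edges G. v \<in> e \<and> c X = h v e \<and>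
      X = (if e \<in> \<Union>Q then {Old v, Subdiv e} else Old ` e)"
    if X: "X \<in> ?E" "Old v \<in> X" for X v
    using shape[OF X(1)] X(2) Q(1) c_old c_sub by (elim disjE bexE) auto
  have at_subdiv: "e \<in> \<Union>Q \<and> ((\<exists>v\<in>e. X = {Old v, Subdiv e} \<and> c X = h v e) \<or>
      (\<exists>p\<in>Q. e \<in> p \<and> X = {Subdiv e, Hub p} \<and> c X = d e))"
    if X: "X \<in> ?E" "Subdiv e \<in> X" for X e
    using shape[OF X(1)] X(2) c_sub c_hub by (elim disjE bexE) auto
  have at_hub: "p \<in> Q \<and> (X = Hub ` Q \<and> c X = k \<or> (\<exists>e\<in>p. X = {Subdiv e, Hub p} \<and> c X = d e))"
    if X: "X \<in> ?E" "Hub p \<in> X" for X p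
    using shape[OF X(1)] X(2) c_mid c_hub by (elim disjE bexE) auto
  have proper: "c X \<noteq> c Y" if X: "X \<in> ?E" "x \<in> X" and Y: "Y \<in> ?E" "x \<in> Y" and "X \<noteq> Y" for X Y x
  proof (cases x)
    case (Old v)
    with at_old[of X v] at_old[of Y v] X Y \<open>X \<noteq> Y\<close> old show ?thesis by metis
  next
    case (Subdiv e)
    \<comment> \<open>Disjoint pairs give a subdividing vertex only one hub.\<close>
    have "p = q" if "p \<in> Q" "q \<in> Q" "e \<in> p" "e \<in> q" for p q
      using Q(2) that by blast
    with Subdiv at_subdiv[of X e] at_subdiv[of Y e] X Y \<open>X \<noteq> Y\<close> subdiv show ?thesis by metis
  next
    case (Hub p)
    with at_hub[of X p] at_hub[of Y p] X Y have
      "p \<in> Q" "X = Hub ` Q \<and> c X = k \<or> (\<exists>e\<in>p. X = {Subdiv e, Hub p} \<and> c X = d e)"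
      "Y = Hub ` Q \<and> c Y = k \<or> (\<exists>e\<in>p. Y = {Subdiv e, Hub p} \<and> c Y = d e)" by auto
    with \<open>X \<noteq> Y\<close> hub show ?thesis by (metis UnionI inj_onD)
  qed
  have colours: "c X \<in> {1, 2, 3}" if X: "X \<in> ?E" for X
  proof -
    have "X \<noteq> {}" using shape[OF X] ne Q_ne by (elim disjE bexE) auto
    then obtain x where "x \<in> X" by blast
    then show ?thesis
      using at_old[OF X] at_subdiv[OF X] at_hub[OF X] range Q(1)
      by (cases x) (metis UnionI subsetD)+
  qed
  show ?thesis
    unfolding three_edge_colourable_def three_edge_colouring_def
    using colours proper by blast
qed

section \<open>Recolouring along a prune-pair\<close>

lemma H_operation_prune_pair_colourable:
  fixes c :: "'a set \<Rightarrow> nat"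
  assumes G: "simple_graph G" and c: "three_edge_colouring G c"
    and E: "{e1, e2, e3, e4} \<subseteq> edges G" "distinct [e1, e2, e3, e4]"
    and cols: "{c1, c2, c3} = {1, 2, 3 :: nat}"
    and p: "coloured_path G c c1 c2 e1 e3 p" and p': "coloured_path G c c1 c3 e2 e4 p'"
    and disj: "set (path_edges p) \<inter> set (path_edges p') = {}"
  shows "three_edge_colourable (H_operation G {{e1, e2}, {e3, e4}})"
proof -
  define I I' where "I = path_interior p" and "I' = path_interior p'"
  \<comment> \<open>The order of the tests is immaterial, as \<open>I\<close> and \<open>I'\<close>
    turn out to be disjoint.\<close>
  define h where "h v e = (if v \<in> I then transpose c1 c2 (c e)
    else if v \<in> I' then transpose c1 c3 (c e) else c e)" for v e
  let ?d = "\<lambda>e. if e \<in> {e1, e3} then c3 else c2"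
  have "card {c1, c2, c3} = 3" unfolding cols by simp
  then have neq: "c1 \<noteq> c2" "c1 \<noteq> c3" "c2 \<noteq> c3" by (auto simp: card_insert_if split: if_splits)
  have colset: "c e = c1 \<or> c e = c2 \<or> c e = c3" if "e \<in> edges G" for e
    using c that cols unfolding three_edge_colouring_def by blast
  have sat: "f \<in> set (path_edges p)" if "v \<in> I" "f \<in> edges G" "v \<in> f" "c f \<in> {c1, c2}" for v f
    using coloured_path_saturated[OF c p] that unfolding I_def by blast
  have sat': "f \<in> set (path_edges p')" if "v \<in> I'" "f \<in> edges G" "v \<in> f" "c f \<in> {c1, c3}" for v f
    using coloured_path_saturated[OF c p'] that unfolding I'_def by blast
  have pe: "distinct p" "path_edges p \<noteq> []" "hd (path_edges p) = e1" "last (path_edges p) = e3"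
      "c e1 = c1" "c e3 \<in> {c1, c2}" "e1 \<in> set (path_edges p)" "e3 \<in> set (path_edges p)"
      "set (path_edges p) \<subseteq> edges G" "\<forall>f\<in>set (path_edges p). c f \<in> {c1, c2}"
    using p unfolding coloured_path_def is_path_def by auto
  have pe': "distinct p'" "path_edges p' \<noteq> []" "hd (path_edges p') = e2" "last (path_edges p') = e4"
      "c e2 = c1" "c e4 \<in> {c1, c3}" "e2 \<in> set (path_edges p')" "e4 \<in> set (path_edges p')"
      "set (path_edges p') \<subseteq> edges G" "\<forall>f\<in>set (path_edges p'). c f \<in> {c1, c3}"
    using p' unfolding coloured_path_def is_path_def by auto
  have inner: "f \<subseteq> I" if "f \<in> set (path_edges p)" "f \<notin> {e1, e2, e3, e4}" for f
    using path_edge_subset_interior[of f p] that pe unfolding I_def by auto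
  have inner': "f \<subseteq> I'" if "f \<in> set (path_edges p')" "f \<notin> {e1, e2, e3, e4}" for f
    using path_edge_subset_interior[of f p'] that pe' unfolding I'_def by auto
  text \<open>At an interior vertex of both paths, its edge of colour \<open>c1\<close> would lie on both.\<close>
  have II': "v \<notin> I'" if vI: "v \<in> I" for v
  proof
    assume "v \<in> I'"
    obtain f g where fg: "f \<in> set (path_edges p)" "g \<in> set (path_edges p)" "f \<noteq> g" "v \<in> f" "v \<in> g"
      using path_interior_two_edges[OF pe(1) vI[unfolded I_def]] .
    then have "c f \<noteq> c g" using c pe(9) unfolding three_edge_colouring_def by blast
    then have "c f = c1 \<or> c g = c1" using fg pe(10) by auto
    then show False using sat'[OF \<open>v \<in> I'\<close>] fg pe(9) disj by blast
  qed
  have h1: "\<exists>u v. e = {u, v} \<and> h u e \<noteq> h v e \<and> h u e \<noteq> c3 \<and> h v e \<noteq> c3" if e: "e \<in> {e1, e3}" for e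
  proof -
    have ends: "hd (path_edges p) \<noteq> last (path_edges p)"
      "e \<in> {hd (path_edges p), last (path_edges p)}"
      using e E(2) pe(3,4) by auto
    obtain u v where uv: "e = {u, v}" "u \<notin> I" "v \<in> I"
      using path_end_edges[OF pe(1,2) ends, folded I_def] .
    \<comment> \<open>Otherwise saturation would put \<open>e\<close> on \<open>p'\<close> too. If
      \<open>c e = c2\<close>, the exchange of \<open>c1\<close> and \<open>c3\<close> fixes this
      colour, so \<open>u\<close> may lie in \<open>I'\<close>.\<close>
    have "u \<notin> I'" if "c e = c1"
      using sat'[of u e] that uv(1) e E(1) pe(7,8) disj by auto
    moreover have "c e \<in> {c1, c2}" using e pe(5,6) by auto
    ultimately have "{h u e, h v e} = {c1, c2}"
      using uv neq by (auto simp: h_def)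
    then show ?thesis using uv(1) neq by (auto simp: doubleton_eq_iff)
  qed
  have h2: "\<exists>u v. e = {u, v} \<and> h u e \<noteq> h v e \<and> h u e \<noteq> c2 \<and> h v e \<noteq> c2" if e: "e \<in> {e2, e4}" for e
  proof -
    have ends: "hd (path_edges p') \<noteq> last (path_edges p')"
      "e \<in> {hd (path_edges p'), last (path_edges p')}"
      using e E(2) pe'(3,4) by auto
    obtain u v where uv: "e = {u, v}" "u \<notin> I'" "v \<in> I'"
      using path_end_edges[OF pe'(1,2) ends, folded I'_def] .
    have "u \<notin> I" if "c e = c1"
      using sat[of u e] that uv(1) e E(1) pe'(7,8) disj by auto
    moreover have "c e \<in> {c1, c3}" using e pe'(5,6) by auto
    \<comment> \<open>\<open>II'\<close> keeps \<open>v\<close> out of \<open>I\<close>, which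
      \<open>h\<close> tests first.\<close>
    ultimately have "{h u e, h v e} = {c1, c3}"
      using uv neq II' by (auto simp: h_def)
    then show ?thesis using uv(1) neq by (auto simp: doubleton_eq_iff)
  qed
  have agree: "h u e = h v e" if e: "e \<in> edges G" "e \<notin> {e1, e2, e3, e4}" and "u \<in> e" "v \<in> e" for u v e
  proof (cases "e \<in> set (path_edges p) \<or> e \<in> set (path_edges p')")
    case True
    then show ?thesis using inner[of e] inner'[of e] II' e(2) that(3,4) by (auto simp: h_def)
  next
    case False
    \<comment> \<open>Off both paths, saturation leaves \<open>e\<close> only a colour that is fixed
      by the exchange at \<open>w\<close>, if there is one.\<close>
    then have "h w e = c e" if "w \<in> e" for w
      using sat[of w e] sat'[of w e] e that by (auto simp: h_def transpose_def)
    then show ?thesis using that by simp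
  qed
  have ends: "\<exists>u v. e = {u, v} \<and> h u e \<noteq> h v e \<and> h u e \<noteq> ?d e \<and> h v e \<noteq> ?d e"
    if "e \<in> {e1, e2, e3, e4}" for e
    using h1[of e] h2[of e] that E(2) by (cases "e \<in> {e1, e3}") auto
  let ?Q = "{{e1, e2}, {e3, e4}}"
  have UQ: "\<Union>?Q = {e1, e2, e3, e4}" by auto
  show ?thesis
  proof (rule H_operation_colourable[where h = h and d = ?d and k = c1], unfold UQ)
    show "e \<noteq> {}" if "e \<in> edges G" for e
      using G that by (auto simp: simple_graph_def)
    show "p \<inter> q = {}" if "p \<in> ?Q" "q \<in> ?Q" "p \<noteq> q" for p q
    proof -
      have "{e1, e2} \<inter> {e3, e4} = {}" using E(2) by auto
      with that show ?thesis by (metis Int_commute insertE singletonD)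
    qed
    show "h v e \<in> {1, 2, 3}" if "e \<in> edges G" "v \<in> e" for v e
      unfolding cols[symmetric] using colset[OF that(1)] by (auto simp: h_def transpose_def)
    show "h v e \<noteq> h v f" if "e \<in> edges G" "f \<in> edges G" "v \<in> e" "v \<in> f" "e \<noteq> f" for v e f
    proof -
      have "c e \<noteq> c f" using c that unfolding three_edge_colouring_def by blast
      \<comment> \<open>At a fixed vertex a single permutation acts on the colours of all
        edges.\<close>
      then show ?thesis by (auto simp: h_def dest: injD[OF inj_transpose])
    qed
    show "h u e = h v e" if "e \<in> edges G - {e1, e2, e3, e4}" "u \<in> e" "v \<in> e" for u v e
      using agree that by (meson DiffD1 DiffD2)
    show "h u e \<noteq> h v e" if "e \<in> {e1, e2, e3, e4}" "u \<in> e" "v \<in> e" "u \<noteq> v" for u v e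
      using ends[OF that(1)] that(2-4) by (elim exE conjE) (metis insertE singletonD)
    show "h v e \<noteq> ?d e" if "e \<in> {e1, e2, e3, e4}" "v \<in> e" for v e
      using ends[OF that(1)] that(2) by (elim exE conjE) (metis insertE singletonD)
    \<comment> \<open>Each pair has one edge in \<open>{e1, e3}\<close> and one in
      \<open>{e2, e4}\<close>.\<close>
    show "inj_on ?d p" if "p \<in> ?Q" for p
    proof -
      have "e2 \<noteq> e1" "e2 \<noteq> e3" "e4 \<noteq> e1" "e4 \<noteq> e3" using E(2) by auto
      with that neq(3) show ?thesis by (elim insertE) (simp_all add: inj_on_def)
    qed
    show "c1 \<in> {1, 2, 3}" "?d e \<in> {1, 2, 3}" for e
      unfolding cols[symmetric] by simp_all
    show "?d e \<noteq> c1" for e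
      using neq by simp
  qed (use E(1) in simp_all)
qed

theorem theorem13:
  fixes G :: "'a graph" and c :: "'a set \<Rightarrow> nat" and e1 e2 e3 e4 :: "'a set"
  assumes "cubic_graph G"
    and "three_edge_colouring G c"
    and "edge_quadruple G {{e1, e2}, {e3, e4}}"
    and "\<exists>p p'. prune_pair G c {{e1, e2}, {e3, e4}} p p'"
  shows "three_edge_colourable (H_operation G {{e1, e2}, {e3, e4}})"
proof -
  let ?Q = "{{e1, e2}, {e3, e4}}"
  obtain f1 f2 f3 f4 where f: "{f1, f2, f3, f4} \<subseteq> edges G" "distinct [f1, f2, f3, f4]"
      "?Q = {{f1, f2}, {f3, f4}}"
    using assms(3) unfolding edge_quadruple_def by (elim exE conjE)
  \<comment> \<open>The prune-pair may order the four edges differently from the given quadruple, so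
    the construction follows its own labels.\<close>
  obtain p p' g1 g2 g3 g4 c1 c2 c3 where g: "?Q = {{g1, g2}, {g3, g4}}"
      and pp: "{c1, c2, c3} = {1, 2, 3 :: nat}" "coloured_path G c c1 c2 g1 g3 p"
      "coloured_path G c c1 c3 g2 g4 p'" "set (path_edges p) \<inter> set (path_edges p') = {}"
    using assms(4) unfolding prune_pair_def by (elim exE conjE)
  have "{{f1, f2}, {f3, f4}} = {{g1, g2}, {g3, g4}}"
    by (rule trans[OF f(3)[symmetric] g])
  from arg_cong[OF this, of Union] have eq: "set [f1, f2, f3, f4] = set [g1, g2, g3, g4]"
    by (simp add: insert_commute)
  \<comment> \<open>Distinctness passes from the \<open>f\<close> labels to the \<open>g\<close>
    labels by counting: both lists have length four and the same set of entries.\<close>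
  then have "card (set [g1, g2, g3, g4]) = length [g1, g2, g3, g4]"
    using distinct_card[OF f(2)] by (metis length_Cons)
  then have "distinct [g1, g2, g3, g4]" by (rule card_distinct)
  moreover have "{g1, g2, g3, g4} \<subseteq> edges G" using eq f(1) by auto
  moreover have "simple_graph G" using assms(1) by (simp add: cubic_graph_def)
  ultimately show ?thesis
    unfolding g using pp assms(2) by (intro H_operation_prune_pair_colourable)
qed

end
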